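(* Let $X$ be a p-closed topological space. (1) If $X$ is strongly p-regular, then $X$ is strongly compact. (2) If $X$ is p-regular, then $X$ is compact. (3) If $X$ is almost p-regular, then $X$ is nearly compact.
   Context: No separation axioms are assumed (compact means every open cover has a finite subcover). A subset $A$ of a space $X$ is preopen if $A \subseteq \mathrm{int}(\mathrm{cl}(A))$; it is preclosed if its complement is preopen, i.e. $\mathrm{cl}(\mathrm{int}(A)) \subseteq A$. The preclosure $\mathrm{pcl}(A)$ is the intersection of all preclosed supersets of $A$. $X$ is p-closed if for every cover $\{V_\alpha : \alpha\in A\}$ of $X$ by preopen sets there is a finite $A_0\subseteq A$ with $X=\bigcup_{\alpha\in A_0}\mathrm{pcl}(V_\alpha)$. $X$ is strongly p-regular (resp. p-regular, almost p-regular) if for each point $x\in X$ and each preclosed set (resp. closed set, regular closed set) $F$ with $x\notin F$, there exist disjoint preopen sets $U$ and $V$ such that $x\in U$ and $F\subseteq V$. A set $U$ is regular open if $U=\mathrm{int}(\mathrm{cl}(U))$; a regular closed set is the complement of a regular open set. $X$ is strongly compact if every cover of $X$ by preopen sets has a finite subcover, and nearly compact if every cover of $X$ by regular open sets has a finite subcover. *)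

theory Defs
  imports "HOL-Analysis.Analysis"
begin

definition preopenin :: "'a topology \<Rightarrow> 'a set \<Rightarrow> bool" where
  "preopenin X A \<longleftrightarrow> A \<subseteq> topspace X \<and> A \<subseteq> X interior_of (X closure_of A)"

definition preclosedin :: "'a topology \<Rightarrow> 'a set \<Rightarrow> bool" where
  "preclosedin X A \<longleftrightarrow> A \<subseteq> topspace X \<and> preopenin X (topspace X - A)"

lemma preclosedin_iff:
  "preclosedin X A \<longleftrightarrow> A \<subseteq> topspace X \<and> X closure_of (X interior_of A) \<subseteq> A"
proof -
  have "X interior_of (X closure_of (topspace X - A)) = topspace X - X closure_of (X interior_of A)"
    by (simp add: closure_of_complement interior_of_complement)
  then show ?thesis
    using closure_of_subset_topspace[of X "X interior_of A"]
    by (auto simp: preclosedin_def preopenin_def)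
qed

text \<open>Meaningful for \<open>A \<subseteq> topspace X\<close>, where \<open>topspace X\<close> itself is a preclosed superset of \<open>A\<close>;
  otherwise the intersection is over the empty family.\<close>
definition preclosure_of :: "'a topology \<Rightarrow> 'a set \<Rightarrow> 'a set" (infixr "preclosure'_of" 80) where
  "X preclosure_of A = \<Inter>{F. preclosedin X F \<and> A \<subseteq> F}"

definition regular_openin :: "'a topology \<Rightarrow> 'a set \<Rightarrow> bool" where
  "regular_openin X U \<longleftrightarrow> U = X interior_of (X closure_of U)"

definition regular_closedin :: "'a topology \<Rightarrow> 'a set \<Rightarrow> bool" where
  "regular_closedin X F \<longleftrightarrow> F \<subseteq> topspace X \<and> regular_openin X (topspace X - F)"

definition p_closed_space :: "'a topology \<Rightarrow> bool" where
  "p_closed_space X \<longleftrightarrow>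
     (\<forall>\<V>. (\<forall>V\<in>\<V>. preopenin X V) \<and> \<Union>\<V> = topspace X \<longrightarrow>
          (\<exists>\<F>. finite \<F> \<and> \<F> \<subseteq> \<V> \<and> (\<Union>V\<in>\<F>. X preclosure_of V) = topspace X))"

definition strongly_p_regular_space :: "'a topology \<Rightarrow> bool" where
  "strongly_p_regular_space X \<longleftrightarrow>
     (\<forall>x F. x \<in> topspace X \<and> preclosedin X F \<and> x \<notin> F \<longrightarrow>
        (\<exists>U V. preopenin X U \<and> preopenin X V \<and> disjnt U V \<and> x \<in> U \<and> F \<subseteq> V))"

definition p_regular_space :: "'a topology \<Rightarrow> bool" where
  "p_regular_space X \<longleftrightarrow>
     (\<forall>x F. x \<in> topspace X \<and> closedin X F \<and> x \<notin> F \<longrightarrow>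
        (\<exists>U V. preopenin X U \<and> preopenin X V \<and> disjnt U V \<and> x \<in> U \<and> F \<subseteq> V))"

definition almost_p_regular_space :: "'a topology \<Rightarrow> bool" where
  "almost_p_regular_space X \<longleftrightarrow>
     (\<forall>x F. x \<in> topspace X \<and> regular_closedin X F \<and> x \<notin> F \<longrightarrow>
        (\<exists>U V. preopenin X U \<and> preopenin X V \<and> disjnt U V \<and> x \<in> U \<and> F \<subseteq> V))"

definition strongly_compact_space :: "'a topology \<Rightarrow> bool" where
  "strongly_compact_space X \<longleftrightarrow>
     (\<forall>\<U>. (\<forall>U\<in>\<U>. preopenin X U) \<and> \<Union>\<U> = topspace X \<longrightarrow>
          (\<exists>\<F>. finite \<F> \<and> \<F> \<subseteq> \<U> \<and> \<Union>\<F> = topspace X))"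

definition nearly_compact_space :: "'a topology \<Rightarrow> bool" where
  "nearly_compact_space X \<longleftrightarrow>
     (\<forall>\<U>. (\<forall>U\<in>\<U>. regular_openin X U) \<and> \<Union>\<U> = topspace X \<longrightarrow>
          (\<exists>\<F>. finite \<F> \<and> \<F> \<subseteq> \<U> \<and> \<Union>\<F> = topspace X))"

end

theory Submission
  imports Defs
begin

text \<open>
  Why p-closedness becomes a compactness property: p-closedness yields finite families whose
  preclosures cover, so one needs a cover whose preclosures still lie inside the members of the
  given cover. Each regularity axiom provides this. If \<open>x \<in> U\<close> and disjoint preopen sets \<open>W\<close>, \<open>V\<close>
  separate \<open>x\<close> from the complement of \<open>U\<close>, so \<open>x \<in> W\<close>, then the complement of \<open>V\<close> is a preclosed set lying
  between \<open>W\<close> and \<open>U\<close>, whence \<open>X preclosure_of W \<subseteq> U\<close> (lemma \<open>preclosure_of_subset_if_separated\<close>).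
  Consequently the preopen sets whose preclosure is contained in some member of the cover form a
  cover themselves, and a finite family extracted from it by p-closedness induces a finite
  subcover (lemma \<open>p_closed_space_finite_subcover\<close>).

  The three parts differ only in the members of the cover, which are preopen, open or regular open;
  their complements are exactly the sets that the respective axiom separates from points.
\<close>

lemma preclosedin_complement:
  assumes "preopenin X U"
  shows "preclosedin X (topspace X - U)"
  using assms by (auto simp: preclosedin_def preopenin_def double_diff)

lemma preclosure_of_subset_if_separated:
  assumes V: "preopenin X V"
    and W: "W \<subseteq> topspace X" "disjnt W V"
    and compl: "topspace X - U \<subseteq> V"
  shows "X preclosure_of W \<subseteq> U"
proof -
  have "preclosedin X (topspace X - V)"
    using V by (rule preclosedin_complement)
  moreover have "W \<subseteq> topspace X - V"
    using W by (auto simp: disjnt_def)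
  ultimately have "X preclosure_of W \<subseteq> topspace X - V"
    unfolding preclosure_of_def by blast
  with compl show ?thesis
    by blast
qed

text \<open>The common core of the three compactness results: the members of the cover may be of any kind,
  as long as points can be separated from their complements by preopen sets.\<close>

lemma p_closed_space_finite_subcover:
  assumes "p_closed_space X"
    and cover: "\<Union>\<U> = topspace X"
    and sep: "\<And>U x. \<lbrakk>U \<in> \<U>; x \<in> U\<rbrakk> \<Longrightarrow>
      \<exists>W V. preopenin X W \<and> preopenin X V \<and> disjnt W V \<and> x \<in> W \<and> topspace X - U \<subseteq> V"
  shows "\<exists>\<F>. finite \<F> \<and> \<F> \<subseteq> \<U> \<and> \<Union>\<F> = topspace X"
proof -
  define \<W> where "\<W> = {W. preopenin X W \<and> (\<exists>U\<in>\<U>. X preclosure_of W \<subseteq> U)}"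
  have "\<exists>W\<in>\<W>. x \<in> W" if "x \<in> topspace X" for x
  proof -
    obtain U where U: "U \<in> \<U>" "x \<in> U"
      using \<open>x \<in> topspace X\<close> cover by blast
    obtain W V where WV: "preopenin X W" "preopenin X V" "disjnt W V" "x \<in> W" "topspace X - U \<subseteq> V"
      using sep[OF U] by blast
    then have "X preclosure_of W \<subseteq> U"
      by (intro preclosure_of_subset_if_separated) (auto simp: preopenin_def)
    then show ?thesis
      using WV U by (auto simp: \<W>_def)
  qed
  then have "\<Union>\<W> = topspace X"
    by (auto simp: \<W>_def preopenin_def)
  moreover have "\<forall>W\<in>\<W>. preopenin X W"
    by (simp add: \<W>_def)
  ultimately obtain \<G> where \<G>: "finite \<G>" "\<G> \<subseteq> \<W>" "(\<Union>W\<in>\<G>. X preclosure_of W) = topspace X"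
    using \<open>p_closed_space X\<close>[unfolded p_closed_space_def, rule_format, of \<W>] by metis
  have "\<forall>W\<in>\<G>. \<exists>U\<in>\<U>. X preclosure_of W \<subseteq> U"
    using \<open>\<G> \<subseteq> \<W>\<close> by (auto simp: \<W>_def)
  then obtain u where u: "\<And>W. W \<in> \<G> \<Longrightarrow> u W \<in> \<U> \<and> X preclosure_of W \<subseteq> u W"
    by metis
  have "\<Union>(u ` \<G>) = topspace X"
  proof
    show "\<Union>(u ` \<G>) \<subseteq> topspace X"
      using u cover by blast
    show "topspace X \<subseteq> \<Union>(u ` \<G>)"
      using u \<G>(3) by blast
  qed
  moreover have "finite (u ` \<G>)" "u ` \<G> \<subseteq> \<U>"
    using u \<G>(1) by auto
  ultimately show ?thesis
    by blast
qed

lemma regular_closedin_complement: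
  assumes "regular_openin X U"
  shows "regular_closedin X (topspace X - U)"
proof -
  have "U \<subseteq> topspace X"
    using assms interior_of_subset_topspace unfolding regular_openin_def by metis
  then show ?thesis
    using assms by (simp add: regular_closedin_def double_diff)
qed

theorem theorem2p8:
  fixes X :: "'a topology"
  assumes "p_closed_space X"
  shows "(strongly_p_regular_space X \<longrightarrow> strongly_compact_space X) \<and>
         (p_regular_space X \<longrightarrow> compact_space X) \<and>
         (almost_p_regular_space X \<longrightarrow> nearly_compact_space X)"
proof (intro conjI impI)
  assume reg: "strongly_p_regular_space X"
  show "strongly_compact_space X"
    unfolding strongly_compact_space_def
  proof (intro allI impI, elim conjE)
    fix \<U> assume \<U>: "\<forall>U\<in>\<U>. preopenin X U" "\<Union>\<U> = topspace X"
    show "\<exists>\<F>. finite \<F> \<and> \<F> \<subseteq> \<U> \<and> \<Union>\<F> = topspace X"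
    proof (rule p_closed_space_finite_subcover[OF assms \<U>(2)])
      fix U x assume "U \<in> \<U>" "x \<in> U"
      then have "x \<in> topspace X" "x \<notin> topspace X - U" "preclosedin X (topspace X - U)"
        using \<U> preclosedin_complement by auto
      then show "\<exists>W V. preopenin X W \<and> preopenin X V \<and> disjnt W V \<and> x \<in> W \<and> topspace X - U \<subseteq> V"
        using reg unfolding strongly_p_regular_space_def by blast
    qed
  qed
next
  assume reg: "p_regular_space X"
  show "compact_space X"
    unfolding compact_space_alt
  proof (intro allI impI, elim conjE)
    fix \<U> assume \<U>: "\<forall>U\<in>\<U>. openin X U" "topspace X \<subseteq> \<Union>\<U>"
    then have cover: "\<Union>\<U> = topspace X"
      using openin_subset by blast
    have "\<exists>\<F>. finite \<F> \<and> \<F> \<subseteq> \<U> \<and> \<Union>\<F> = topspace X"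
    proof (rule p_closed_space_finite_subcover[OF assms cover])
      fix U x assume "U \<in> \<U>" "x \<in> U"
      then have "x \<in> topspace X" "x \<notin> topspace X - U" "closedin X (topspace X - U)"
        using \<U> cover by auto
      then show "\<exists>W V. preopenin X W \<and> preopenin X V \<and> disjnt W V \<and> x \<in> W \<and> topspace X - U \<subseteq> V"
        using reg unfolding p_regular_space_def by blast
    qed
    then show "\<exists>\<F>. finite \<F> \<and> \<F> \<subseteq> \<U> \<and> topspace X \<subseteq> \<Union>\<F>"
      by (metis order_refl)
  qed
next
  assume reg: "almost_p_regular_space X"
  show "nearly_compact_space X"
    unfolding nearly_compact_space_def
  proof (intro allI impI, elim conjE)
    fix \<U> assume \<U>: "\<forall>U\<in>\<U>. regular_openin X U" "\<Union>\<U> = topspace X"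
    show "\<exists>\<F>. finite \<F> \<and> \<F> \<subseteq> \<U> \<and> \<Union>\<F> = topspace X"
    proof (rule p_closed_space_finite_subcover[OF assms \<U>(2)])
      fix U x assume "U \<in> \<U>" "x \<in> U"
      then have "x \<in> topspace X" "x \<notin> topspace X - U" "regular_closedin X (topspace X - U)"
        using \<U> regular_closedin_complement by auto
      then show "\<exists>W V. preopenin X W \<and> preopenin X V \<and> disjnt W V \<and> x \<in> W \<and> topspace X - U \<subseteq> V"
        using reg unfolding almost_p_regular_space_def by blast
    qed
  qed
qed

end
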